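(* Let $t\ge2$ be an integer and $\rho>0$ a real number. For each $P>0$ let $\mathsf{Q}=\mathsf{Q}_P=\{(\mathbf{x}_n,\mathcal{E}_n,\mathsf{b}_n)\}_{n\in\mathcal{I}}$ with $\mathcal{I}\subset\mathbb{N}$ be a quantizer (all of its components may depend on $P$), and suppose that $\mathrm{R}(\mathsf{Q}_P)\in o(1/P)$ as $P\to\infty$, i.e. for every $\varepsilon>0$ one has $\mathrm{R}(\mathsf{Q}_P)\le\varepsilon/P$ for all sufficiently large $P$. Then $\mathrm{OUT}(\mathsf{Q}_P)>\mathrm{OUT}(\mathrm{Full})$ for all sufficiently large $P$.
   Context: $\mathbb{N}=\{0,1,2,\dots\}$. The channel state $\mathbf{h}=(h_1,\dots,h_t)^T\in\mathbb{C}^t$ is a random vector with i.i.d. standard circularly symmetric complex Gaussian entries $h_i\sim\mathcal{CN}(0,1)$, i.e. with density $\pi^{-t}e^{-\|\mathbf{h}\|^2}$ on $\mathbb{C}^t$. $\langle\cdot,\cdot\rangle$ is the standard Hermitian inner product and $\|\cdot\|$ the Euclidean norm on $\mathbb{C}^t$. $P>0$ is the transmit power, $\rho>0$ the (fixed) target rate, and $\alpha=(2^\rho-1)/P$. The set of beamforming vectors is $\mathcal{X}_{\mathrm{BF}}=\{\mathbf{x}\in\mathbb{C}^t:\|\mathbf{x}\|=1\}$. A quantizer is a collection of triples $\mathsf{Q}=\{(\mathbf{x}_n,\mathcal{E}_n,\mathsf{b}_n)\}_{n\in\mathcal{I}}$, $\mathcal{I}\subset\mathbb{N}$ (finite or infinite),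 where $\mathbf{x}_n\in\mathcal{X}_{\mathrm{BF}}$, the $\mathcal{E}_n$ are mutually disjoint measurable subsets of $\mathbb{C}^t$ with union $\mathbb{C}^t$, and the $\mathsf{b}_n$ are distinct binary words (the empty word is allowed; no prefix-free condition is imposed). One writes $\mathsf{Q}(\mathbf{h})=\mathbf{x}_n$ if $\mathbf{h}\in\mathcal{E}_n$. The outage probability of $\mathsf{Q}$ at power $P$ is $\mathrm{OUT}(\mathsf{Q})=\Pr(|\langle\mathsf{Q}(\mathbf{h}),\mathbf{h}\rangle|^2<\alpha)$, and its rate is $\mathrm{R}(\mathsf{Q})=\sum_{n\in\mathcal{I}}\Pr(\mathbf{h}\in\mathcal{E}_n)\,\mathrm{L}(\mathsf{b}_n)$, where $\mathrm{L}(\mathsf{b})$ is the length of the word $\mathsf{b}$ (the empty word has length $0$; words of infinite length, with $\mathrm{L}=\infty$, are allowed, with the convention $0\cdot\infty=0$). The full-CSIT outage probability at power $P$ is $\mathrm{OUT}(\mathrm{Full})=\Pr(\|\mathbf{h}\|^2<\alpha)$. *)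

theory Defs
  imports "HOL-Analysis.Analysis"
begin

(* Finite words or right-infinite bit sequences. *)
datatype binary_word = Finite_Word "bool list" | Infinite_Word "nat \<Rightarrow> bool"

fun word_length :: "binary_word \<Rightarrow> enat" where
  "word_length (Finite_Word w) = enat (length w)"
| "word_length (Infinite_Word s) = \<infinity>"

(* The library's inner product on complex^'t is real-valued (the real part of this one).
   The convention is linear in the first argument; only the modulus is ever used. *)
definition hermitian_inner :: "complex^'t \<Rightarrow> complex^'t \<Rightarrow> complex" where
  "hermitian_inner x y = (\<Sum>i\<in>UNIV. x $ i * cnj (y $ i))"

(* The law of the channel state, whose entries are i.i.d. CN(0,1): one complex entry has density
   exp (-|z|^2) / pi with respect to Lebesgue measure on C = R^2.  Based on lebesgue rather than
   lborel, so that the quantization cells may be arbitrary Lebesgue measurable sets. *)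
definition channel :: "(complex^'t) measure" where
  "channel = density lebesgue (\<lambda>h. ennreal (exp (- (norm h)\<^sup>2) / pi ^ CARD('t)))"

definition beamforming_vectors :: "(complex^'t) set" where
  "beamforming_vectors = {x. norm x = 1}"

record ('t::finite) quantizer =
  indices :: "nat set"
  beam :: "nat \<Rightarrow> complex^'t"
  cell :: "nat \<Rightarrow> (complex^'t) set"
  codeword :: "nat \<Rightarrow> binary_word"

(* The components are only constrained on the index set. *)
definition is_quantizer :: "'t::finite quantizer \<Rightarrow> bool" where
  "is_quantizer Q \<longleftrightarrow>
     (\<forall>n\<in>indices Q. beam Q n \<in> beamforming_vectors) \<and>
     (\<forall>n\<in>indices Q. cell Q n \<in> sets lebesgue) \<and>
     disjoint_family_on (cell Q) (indices Q) \<and>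
     (\<Union>n\<in>indices Q. cell Q n) = UNIV \<and>
     inj_on (codeword Q) (indices Q)"

definition quantize :: "'t::finite quantizer \<Rightarrow> complex^'t \<Rightarrow> complex^'t" where
  "quantize Q h = beam Q (THE n. n \<in> indices Q \<and> h \<in> cell Q n)"

definition outage_threshold :: "real \<Rightarrow> real \<Rightarrow> real" where
  "outage_threshold \<rho> P = (2 powr \<rho> - 1) / P"

definition outage :: "real \<Rightarrow> real \<Rightarrow> 't::finite quantizer \<Rightarrow> real" where
  "outage \<rho> P Q =
     measure channel {h. (cmod (hermitian_inner (quantize Q h) h))\<^sup>2 < outage_threshold \<rho> P}"

definition outage_full :: "'t::finite itself \<Rightarrow> real \<Rightarrow> real \<Rightarrow> real" where
  "outage_full _ \<rho> P =
     measure channel {h :: complex^'t. (norm h)\<^sup>2 < outage_threshold \<rho> P}"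

(* Valued in ennreal: the rate may be infinite, and 0 * \<infinity> = 0 there. *)
definition rate :: "'t::finite quantizer \<Rightarrow> ennreal" where
  "rate Q = (\<Sum>\<^sub>\<infinity>n\<in>indices Q. emeasure channel (cell Q n) * ennreal_of_enat (word_length (codeword Q n)))"

end

theory Submission
  imports Defs
begin

text \<open>
  Every word but the empty one has length at least 1, so the rate bounds the probability that the
  codeword is nonempty; outside that event the quantizer uses one fixed beam \<open>x\<close>. If
  the outage probability equalled that of full CSIT, then up to a null set every \<open>h\<close> with
  \<open>\<bar>\<langle>x, h\<rangle>\<bar>\<^sup>2 < \<alpha> \<le> \<parallel>h\<parallel>\<^sup>2\<close> would get a nonempty codeword. The probability of these
  \<open>h\<close> is at least a constant times \<open>\<alpha>\<close>, that is, of order at least \<open>1/P\<close>,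
  uniformly in \<open>x\<close>, contradicting the rate assumption.
\<close>

section \<open>The Hermitian form: translation along the beam and Cauchy-Schwarz\<close>

lemma norm_vector_scalar_mult: "norm (c *s x) = cmod c * norm x" for x :: "complex^'t"
  by (simp add: norm_vec_def norm_mult L2_set_right_distrib)

text \<open>Lets the covering argument slide \<open>h\<close> along a unit vector \<open>x\<close>
  until the inner product is small. The conjugate on \<open>c\<close> comes from antilinearity in
  the second argument.\<close>

lemma hermitian_inner_add_scalar:
  "hermitian_inner x (h + c *s x) = hermitian_inner x h + cnj c * (norm x)\<^sup>2"
proof -
  have "(of_real ((norm x)\<^sup>2) :: complex) = (\<Sum>i\<in>UNIV. x $ i * cnj (x $ i))"
    by (simp add: norm_vec_def L2_set_def sum_nonneg complex_norm_square[symmetric])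
  then show ?thesis
    by (simp add: hermitian_inner_def algebra_simps sum.distrib sum_distrib_left)
qed

text \<open>Cauchy-Schwarz, reduced by the triangle inequality to the real case for the moduli of
  the entries.\<close>

lemma cmod_hermitian_inner_le: "cmod (hermitian_inner x h) \<le> norm x * norm h"
proof -
  have "cmod (hermitian_inner x h) \<le> (\<Sum>i\<in>UNIV. \<bar>cmod (x $ i)\<bar> * \<bar>cmod (h $ i)\<bar>)"
    unfolding hermitian_inner_def by (rule order_trans[OF norm_sum]) (simp add: norm_mult)
  also have "\<dots> \<le> norm x * norm h"
    unfolding norm_vec_def by (rule L2_set_mult_ineq)
  finally show ?thesis .
qed

lemma continuous_on_hermitian_inner [continuous_intros]: "continuous_on S (hermitian_inner x)"
  unfolding hermitian_inner_def[abs_def] by (intro continuous_intros)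

section \<open>The Gaussian law: comparison with volume, and finiteness\<close>

lemma sets_channel [simp]: "sets channel = sets lebesgue"
  by (simp add: channel_def)

lemma space_channel [simp]: "space channel = UNIV"
  by (simp add: channel_def)

lemma emeasure_channel:
  fixes A :: "(complex^'t) set"
  assumes "A \<in> sets lebesgue"
  shows "emeasure channel A =
    (\<integral>\<^sup>+h. ennreal (exp (- (norm h)\<^sup>2) / pi ^ CARD('t)) * indicator A h \<partial>lebesgue)"
proof -
  have "(\<lambda>h::complex^'t. ennreal (exp (- (norm h)\<^sup>2) / pi ^ CARD('t))) \<in> borel_measurable lebesgue"
    by (rule measurable_completion) simp
  then show ?thesis
    using assms by (simp add: channel_def emeasure_density)
qed

text \<open>The density decreases with the norm, so on \<open>A\<close> it is at least its value at
  radius \<open>R\<close>.\<close>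

lemma emeasure_channel_ge:
  fixes A :: "(complex^'t) set"
  assumes "A \<in> sets lebesgue" and "\<And>h. h \<in> A \<Longrightarrow> norm h \<le> R"
  shows "emeasure channel A \<ge> ennreal (exp (- R\<^sup>2) / pi ^ CARD('t)) * emeasure lebesgue A"
proof -
  have "ennreal (exp (- R\<^sup>2) / pi ^ CARD('t)) * emeasure lebesgue A =
      (\<integral>\<^sup>+h. ennreal (exp (- R\<^sup>2) / pi ^ CARD('t)) * indicator A h \<partial>lebesgue)"
    using assms(1) by (simp add: nn_integral_cmult_indicator)
  also have "\<dots> \<le> emeasure channel A"
    unfolding emeasure_channel[OF assms(1)] using assms(2)
    by (intro nn_integral_mono)
      (auto simp: indicator_def intro!: ennreal_leI divide_right_mono power_mono)
  finally show ?thesis .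
qed

lemma emeasure_channel_le:
  fixes A :: "(complex^'t) set"
  assumes "A \<in> sets lebesgue" and "0 \<le> R" and "\<And>h. h \<in> A \<Longrightarrow> R \<le> norm h"
  shows "emeasure channel A \<le> ennreal (exp (- R\<^sup>2) / pi ^ CARD('t)) * emeasure lebesgue A"
proof -
  have "emeasure channel A \<le>
      (\<integral>\<^sup>+h. ennreal (exp (- R\<^sup>2) / pi ^ CARD('t)) * indicator A h \<partial>lebesgue)"
    unfolding emeasure_channel[OF assms(1)] using assms(2,3)
    by (intro nn_integral_mono)
      (auto simp: indicator_def intro!: ennreal_leI divide_right_mono power_mono)
  then show ?thesis
    using assms(1) by (simp add: nn_integral_cmult_indicator)
qed

lemma emeasure_lebesgue_ball:
  assumes "0 \<le> r"
  shows "emeasure lebesgue (ball (0 :: complex^'t) r) =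
    ennreal (unit_ball_vol (2 * CARD('t)) * r ^ (2 * CARD('t)))"
  using emeasure_ball[OF assms, of "0 :: complex^'t"] by (simp add: mult.commute)

text \<open>Comparison with a geometric series of ratio \<open>exp (-1/2)\<close>: half of the decay
  of \<open>exp (- real k)\<close> is spent on absorbing the polynomial factor.\<close>

lemma summable_exp_square_power: "summable (\<lambda>k. exp (- (real k)\<^sup>2) * (real k + 1) ^ d)"
proof (rule summable_comparison_test)
  define q where "q = exp (-1/2 :: real)"
  define C where "C = 2 ^ d * fact d * exp (1/2 :: real)"
  have le: "exp (- (real k)\<^sup>2) * (real k + 1) ^ d \<le> C * q ^ k" for k
  proof -
    \<comment> \<open>The halving makes \<open>exp (- real k) * exp y\<close> equal to
      \<open>exp (1/2) * q ^ k\<close>. A single term of the exponential series bounds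
      \<open>y ^ d\<close>.\<close>
    define y where "y = (real k + 1) / 2"
    have "y ^ d /\<^sub>R fact d \<le> exp y"
      using sum_le_suminf[OF summable_exp_generic, of "{d}" y] by (simp add: exp_def y_def)
    then have "y ^ d \<le> fact d * exp y"
      by (simp add: field_simps)
    then have "2 ^ d * y ^ d \<le> 2 ^ d * (fact d * exp y)"
      by (rule mult_left_mono) simp
    moreover have "2 ^ d * y ^ d = (real k + 1) ^ d"
      by (simp add: y_def power_divide)
    moreover have "real k \<le> (real k)\<^sup>2"
      by (cases k) (auto simp: power2_eq_square)
    ultimately have "exp (- (real k)\<^sup>2) * (real k + 1) ^ d \<le> exp (- real k) * (2 ^ d * (fact d * exp y))"
      by (intro mult_mono) auto
    also have "exp (- real k) * (2 ^ d * (fact d * exp y)) = 2 ^ d * fact d * (exp (- real k) * exp y)"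
      by (simp only: mult_ac)
    also have "exp (- real k) * exp y = exp (1/2) * q ^ k"
    proof -
      have "- real k + y = 1/2 + real k * (-1/2)" unfolding y_def by argo
      then show ?thesis unfolding q_def exp_of_nat_mult[symmetric] exp_add[symmetric] by simp
    qed
    finally show ?thesis by (simp only: C_def mult_ac)
  qed
  then show "\<exists>N. \<forall>n\<ge>N. norm (exp (- (real n)\<^sup>2) * (real n + 1) ^ d) \<le> C * q ^ n"
    by (simp del: power_Suc)
  have "norm q < 1" by (simp add: q_def)
  then show "summable (\<lambda>n. C * q ^ n)"
    by (intro summable_mult summable_geometric)
qed

text \<open>Cut the space into shells of width 1 and bound each by the density at its inner radius
  times the volume of its outer ball. Finiteness lets \<open>measure\<close> be exchanged for
  \<open>emeasure\<close> and differences of sets be subtracted.\<close>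

lemma emeasure_channel_finite: "emeasure (channel :: (complex^'t) measure) A \<noteq> \<infinity>"
proof -
  define B where "B k = {h :: complex^'t. real k \<le> norm h \<and> norm h < real k + 1}" for k
  define V where "V = unit_ball_vol (2 * CARD('t)) / pi ^ CARD('t)"
  have V: "0 \<le> V" by (simp add: V_def)
  have B: "B k \<in> sets lebesgue" for k
  proof -
    have "B k \<in> sets borel" unfolding B_def by measurable
    then show ?thesis by (simp add: sets_completionI_sets)
  qed
  have "h \<in> B (nat \<lfloor>norm h\<rfloor>)" for h
    by (simp add: B_def)
  then have UN: "(\<Union>k. B k) = UNIV" by blast
  have le: "emeasure channel (B k) \<le> ennreal (V * (exp (- (real k)\<^sup>2) * (real k + 1) ^ (2 * CARD('t))))" for k
  proof -
    have "emeasure channel (B k) \<le> ennreal (exp (- (real k)\<^sup>2) / pi ^ CARD('t)) * emeasure lebesgue (B k)"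
      by (rule emeasure_channel_le[OF B]) (auto simp: B_def)
    also have "\<dots> \<le> ennreal (exp (- (real k)\<^sup>2) / pi ^ CARD('t)) * emeasure lebesgue (ball (0 :: complex^'t) (real k + 1))"
      by (intro mult_left_mono emeasure_mono) (auto simp: B_def)
    also have "\<dots> = ennreal (V * (exp (- (real k)\<^sup>2) * (real k + 1) ^ (2 * CARD('t))))"
      by (subst emeasure_lebesgue_ball) (auto simp: V_def ennreal_mult[symmetric])
    finally show ?thesis .
  qed
  have "emeasure (channel :: (complex^'t) measure) A \<le> emeasure channel (\<Union>k. B k)"
    unfolding UN by (metis emeasure_space space_channel)
  also have "\<dots> \<le> (\<Sum>k. emeasure channel (B k))"
    by (rule emeasure_subadditive_countably) (use B in auto)
  also have "\<dots> \<le> (\<Sum>k. ennreal (V * (exp (- (real k)\<^sup>2) * (real k + 1) ^ (2 * CARD('t)))))"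
    by (intro suminf_le le) auto
  also have "\<dots> < \<infinity>"
    using V by (subst suminf_ennreal2) (auto intro!: summable_mult summable_exp_square_power)
  finally show ?thesis by simp
qed

section \<open>Volume and probability of the slab around the hyperplane orthogonal to a beam\<close>

text \<open>Translates of the slab along \<open>x\<close> by the points of a square grid of mesh \<open>r\<close> cover the unit
  ball. This needs only translation invariance of the volume, and so is uniform in \<open>x\<close>.\<close>

lemma emeasure_lebesgue_slab_ge:
  fixes x :: "complex^'t"
  assumes x: "norm x = 1" and r: "0 < r" "r \<le> 1"
  defines "S \<equiv> {h. cmod (hermitian_inner x h) < r \<and> norm h \<le> 3}"
  shows "S \<in> sets lebesgue"
    and "emeasure lebesgue S \<ge> ennreal (unit_ball_vol (2 * CARD('t)) * r\<^sup>2 / 25)"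
proof -
  define m where "m = \<lceil>1 / r\<rceil>"
  define I where "I = {-m..m} \<times> {-m..m}"
  define c where "c p = Complex (of_int (fst p) * r) (of_int (snd p) * r)" for p :: "int \<times> int"
  define T where "T p = (+) (c p *s x) ` S" for p
  have "open {h. cmod (hermitian_inner x h) < r}"
    by (intro open_Collect_less continuous_intros)
  moreover have "S = {h. cmod (hermitian_inner x h) < r} \<inter> cball 0 3"
    by (auto simp: S_def)
  ultimately have "S \<in> sets borel" by simp
  then show meas: "S \<in> sets lebesgue" by (simp add: sets_completionI_sets)
  have "S \<subseteq> cball 0 3" by (auto simp: S_def)
  then have lm: "S \<in> lmeasurable"
    using meas by (meson fmeasurableI2 lmeasurable_cball)
  have cover: "ball 0 1 \<subseteq> (\<Union>p\<in>I. T p)"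
  proof
    fix h :: "complex^'t" assume "h \<in> ball 0 1"
    then have h: "norm h < 1" by simp
    \<comment> \<open>For this \<open>z\<close>, the vector \<open>h - z *s x\<close> is orthogonal
      to \<open>x\<close>; \<open>c p\<close> will be the grid point nearest to
      \<open>z\<close>.\<close>
    define z where "z = cnj (hermitian_inner x h)"
    have z: "cmod z \<le> 1"
      using cmod_hermitian_inner_le[of x h] h x by (simp add: z_def)
    define p where "p = (round (Re z / r), round (Im z / r))"
    have *: "\<bar>of_int (round (u / r)) * r - u\<bar> \<le> r / 2" "\<bar>round (u / r)\<bar> \<le> m" if "\<bar>u\<bar> \<le> 1" for u
    proof -
      have "\<bar>of_int (round (u / r)) - u / r\<bar> \<le> 1 / 2" by (rule of_int_round_abs_le)
      then have "\<bar>of_int (round (u / r)) - u / r\<bar> * r \<le> 1 / 2 * r"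
        using r by (intro mult_right_mono) auto
      moreover have "\<bar>of_int (round (u / r)) - u / r\<bar> * r = \<bar>(of_int (round (u / r)) - u / r) * r\<bar>"
        using r by (simp add: abs_mult)
      moreover have "(of_int (round (u / r)) - u / r) * r = of_int (round (u / r)) * r - u"
        using r by (simp add: left_diff_distrib)
      ultimately show "\<bar>of_int (round (u / r)) * r - u\<bar> \<le> r / 2" by simp
      have "\<bar>u / r\<bar> \<le> 1 / r" using that r by (simp add: abs_divide divide_right_mono)
      then have "u / r \<le> of_int m" "- of_int m \<le> u / r"
        unfolding m_def by linarith+
      then have "round (u / r) \<le> round (of_int m :: real)" "round (of_int (- m) :: real) \<le> round (u / r)"
        by (intro round_mono; simp)+
      then show "\<bar>round (u / r)\<bar> \<le> m" unfolding round_of_int by linarith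
    qed
    have zz: "\<bar>Re z\<bar> \<le> 1" "\<bar>Im z\<bar> \<le> 1"
      using z abs_Re_le_cmod[of z] abs_Im_le_cmod[of z] by linarith+
    have pI: "p \<in> I" using *(2)[OF zz(1)] *(2)[OF zz(2)] by (auto simp: I_def p_def)
    have "(Re (c p - z))\<^sup>2 \<le> (r / 2)\<^sup>2" "(Im (c p - z))\<^sup>2 \<le> (r / 2)\<^sup>2"
      using *(1)[OF zz(1)] *(1)[OF zz(2)] r
      by (auto simp: c_def p_def abs_le_square_iff[symmetric])
    \<comment> \<open>Rounding errs by at most \<open>r / 2\<close> in each coordinate, hence by at
      most \<open>r / sqrt 2\<close> in modulus, strictly below \<open>r\<close>.\<close>
    then have "(cmod (c p - z))\<^sup>2 \<le> (r / 2)\<^sup>2 + (r / 2)\<^sup>2"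
      unfolding cmod_power2 by linarith
    also have "\<dots> < r\<^sup>2" using r by (simp add: power2_eq_square)
    finally have cz: "cmod (c p - z) < r"
      using r by (simp add: power_less_imp_less_base)
    have "hermitian_inner x (h - c p *s x) = cnj (z - c p)"
      using hermitian_inner_add_scalar[of x h "- c p"] x by (simp add: z_def)
    then have "cmod (hermitian_inner x (h - c p *s x)) < r"
      using cz by (metis complex_mod_cnj norm_minus_commute)
    \<comment> \<open>The radius 3 is 1 for \<open>h\<close>, 1 for \<open>z\<close> and
      \<open>r \<le> 1\<close> for the rounding error.\<close>
    moreover have "norm (h - c p *s x) \<le> 3"
    proof -
      have "norm (h - c p *s x) \<le> norm h + cmod (c p)"
        using norm_triangle_ineq4[of h "c p *s x"] x by (simp add: norm_vector_scalar_mult)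
      moreover have "cmod (c p) \<le> cmod (c p - z) + cmod z" by norm
      ultimately show ?thesis using h z cz r by linarith
    qed
    ultimately have "h - c p *s x \<in> S" by (simp add: S_def)
    then have "h \<in> T p" unfolding T_def by (rule image_eqI[rotated]) simp
    then show "h \<in> (\<Union>p\<in>I. T p)" using pI by blast
  qed
  have fin: "finite I" by (simp add: I_def)
  have T: "T p \<in> lmeasurable" "measure lebesgue (T p) = measure lebesgue S" for p
    unfolding T_def by (rule measurable_translation[OF lm]) (rule measure_translation)
  \<comment> \<open>The grid has \<open>2 * m + 1\<close> points per side. Rounding up gives at most
    \<open>2 / r + 3\<close>, and \<open>1 \<le> 1 / r\<close> turns this into \<open>5 / r\<close>;
    its square is the source of 25.\<close>
  have m: "2 * real_of_int m + 1 \<le> 5 / r" "0 \<le> m"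
  proof -
    have "real_of_int m \<le> 1 / r + 1" unfolding m_def by linarith
    moreover have r1: "1 \<le> 1 / r" using r by simp
    ultimately have "2 * real_of_int m + 1 \<le> 5 * (1 / r)" by linarith
    then show "2 * real_of_int m + 1 \<le> 5 / r" by simp
    show "0 \<le> m" using r1 unfolding m_def by linarith
  qed
  have "real (card I) = (2 * real_of_int m + 1)\<^sup>2"
    using m(2) by (simp add: I_def card_cartesian_product power2_eq_square)
  also have "\<dots> \<le> (5 / r)\<^sup>2"
    using m by (intro power_mono) auto
  finally have card: "real (card I) \<le> 25 / r\<^sup>2" by (simp add: power_divide)
  have "unit_ball_vol (2 * CARD('t)) = measure lebesgue (ball (0 :: complex^'t) 1)"
    using emeasure_lebesgue_ball[of 1, where 't = 't] by (simp add: measure_def)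
  also have "\<dots> \<le> measure lebesgue (\<Union>p\<in>I. T p)"
    using T fin by (intro measure_mono_fmeasurable cover fmeasurable.finite_UN) auto
  also have "\<dots> \<le> (\<Sum>p\<in>I. measure lebesgue (T p))"
    using T by (intro measure_UNION_le fin) auto
  also have "\<dots> = real (card I) * measure lebesgue S" by (simp add: T)
  also have "\<dots> \<le> 25 / r\<^sup>2 * measure lebesgue S"
    by (intro mult_right_mono card) simp
  finally have "unit_ball_vol (2 * CARD('t)) * r\<^sup>2 / 25 \<le> measure lebesgue S"
    using r by (simp add: field_simps)
  then show "emeasure lebesgue S \<ge> ennreal (unit_ball_vol (2 * CARD('t)) * r\<^sup>2 / 25)"
    using lm by (simp add: emeasure_eq_measure2)
qed

lemma sets_lebesgue_beam_outage: "{h. (cmod (hermitian_inner x h))\<^sup>2 < a} \<in> sets lebesgue"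
proof -
  have "open {h. (cmod (hermitian_inner x h))\<^sup>2 < a}"
    by (intro open_Collect_less continuous_intros)
  then show ?thesis by (simp add: sets_completionI_sets)
qed

lemma sets_lebesgue_full_outage: "{h :: complex^'t. (norm h)\<^sup>2 < a} \<in> sets lebesgue"
proof -
  have "open {h :: complex^'t. (norm h)\<^sup>2 < a}"
    by (intro open_Collect_less continuous_intros)
  then show ?thesis by (simp add: sets_completionI_sets)
qed

lemma sq_less_iff_less_sqrt: "u\<^sup>2 < a \<longleftrightarrow> u < sqrt a" if "0 \<le> u" for u a :: real
  using that real_less_rsqrt real_less_lsqrt
  by (metis real_sqrt_less_iff real_sqrt_unique)

text \<open>The slab has probability of order \<open>a\<close>, the ball only of order \<open>a ^ CARD('t)\<close>.\<close>

lemma fixed_beam_outage_gap: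
  assumes t: "CARD('t::finite) \<ge> 2"
  obtains c a\<^sub>0 where "0 < c" "0 < a\<^sub>0"
    "\<And>a (x :: complex^'t). 0 < a \<Longrightarrow> a \<le> a\<^sub>0 \<Longrightarrow> norm x = 1 \<Longrightarrow>
      ennreal (c * a) \<le> emeasure channel
        ({h :: complex^'t. (cmod (hermitian_inner x h))\<^sup>2 < a} - {h. (norm h)\<^sup>2 < a})"
proof -
  define V where "V = unit_ball_vol (2 * CARD('t)) / pi ^ CARD('t)"
  \<comment> \<open>The factor \<open>exp (-9)\<close> comes from the density at radius 3, where the
    slab is cut off; 25 is the grid constant.\<close>
  define k where "k = exp (-9 :: real) / 25"
  have V: "0 < V" by (simp add: V_def)
  have k: "0 < k" "k \<le> 1" by (auto simp: k_def intro: order_trans[of _ 1])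
  have main: "ennreal (V * k / 2 * a) \<le> emeasure channel
        ({h :: complex^'t. (cmod (hermitian_inner x h))\<^sup>2 < a} - {h. (norm h)\<^sup>2 < a})"
    (is "_ \<le> emeasure _ (?A - ?B)")
    if a: "0 < a" "a \<le> k / 2" and x: "norm x = 1" for a and x :: "complex^'t"
  proof -
    have a1: "a \<le> 1" using a k by linarith
    define S where "S = {h. cmod (hermitian_inner x h) < sqrt a \<and> norm h \<le> 3}"
    have r: "0 < sqrt a" "sqrt a \<le> 1" using a a1 by auto
    note slab = emeasure_lebesgue_slab_ge[OF x r, folded S_def]
    have SA: "S \<subseteq> ?A" by (auto simp: S_def sq_less_iff_less_sqrt)
    have "ennreal (V * k * a) = ennreal (exp (- 3\<^sup>2) / pi ^ CARD('t)) *
        ennreal (unit_ball_vol (2 * CARD('t)) * (sqrt a)\<^sup>2 / 25)"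
      using a by (subst ennreal_mult[symmetric]) (auto simp: V_def k_def)
    also have "\<dots> \<le> ennreal (exp (- 3\<^sup>2) / pi ^ CARD('t)) * emeasure lebesgue S"
      by (intro mult_left_mono slab(2)) simp
    also have "\<dots> \<le> emeasure channel S"
      by (rule emeasure_channel_ge[OF slab(1)]) (simp add: S_def)
    also have "\<dots> \<le> emeasure channel ?A"
      by (intro emeasure_mono SA) (simp add: sets_lebesgue_beam_outage)
    also have "\<dots> \<le> emeasure channel ((?A - ?B) \<union> ?B)"
      by (intro emeasure_mono)
        (auto intro!: sets.Un sets.Diff sets_lebesgue_beam_outage sets_lebesgue_full_outage)
    also have "\<dots> \<le> emeasure channel (?A - ?B) + emeasure channel ?B"
      by (intro emeasure_subadditive)
        (auto intro!: sets.Diff sets_lebesgue_beam_outage sets_lebesgue_full_outage)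
    \<comment> \<open>The ball of radius \<open>sqrt a\<close> has volume of order
      \<open>a ^ CARD('t)\<close>, and this power is at most \<open>a\<^sup>2\<close> because
      \<open>CARD('t)\<close> is at least 2 and \<open>a \<le> 1\<close>. Then
      \<open>a \<le> k / 2\<close> keeps the ball below half of the slab bound.\<close>
    also have "emeasure channel ?B \<le> ennreal (V * k / 2 * a)"
    proof -
      have B: "?B = ball (0 :: complex^'t) (sqrt a)" by (auto simp: sq_less_iff_less_sqrt)
      have "emeasure channel ?B \<le> ennreal (exp (- 0\<^sup>2) / pi ^ CARD('t)) * emeasure lebesgue ?B"
        by (intro emeasure_channel_le sets_lebesgue_full_outage) auto
      also have "\<dots> = ennreal (V * a ^ CARD('t))"
        unfolding B using a
        by (subst emeasure_lebesgue_ball) (auto simp: ennreal_mult[symmetric] V_def power_mult)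
      also have "\<dots> \<le> ennreal (V * k / 2 * a)"
      proof (rule ennreal_leI)
        have "a ^ CARD('t) \<le> a\<^sup>2" using t a a1 by (intro power_decreasing) auto
        also have "\<dots> \<le> k / 2 * a" using a by (simp add: power2_eq_square)
        finally show "V * a ^ CARD('t) \<le> V * k / 2 * a" using V by simp
      qed
      finally show ?thesis .
    qed
    finally have "ennreal (V * k * a) \<le> emeasure channel (?A - ?B) + ennreal (V * k / 2 * a)"
      by (simp add: add_left_mono)
    moreover have "ennreal (V * k * a) = ennreal (V * k / 2 * a) + ennreal (V * k / 2 * a)"
      using V k a by (subst ennreal_plus[symmetric]) auto
    ultimately show ?thesis
      by (simp add: ennreal_add_left_cancel_le add.commute)
  qed
  show ?thesis
    by (rule that[of "V * k / 2" "k / 2"]) (use V k main in auto)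
qed

section \<open>Rate and outage of a quantizer\<close>

text \<open>Markov's inequality for the codeword length.\<close>

lemma emeasure_nonempty_codeword_le_rate:
  assumes Q: "is_quantizer Q"
  shows "emeasure channel (\<Union>n\<in>{n\<in>indices Q. word_length (codeword Q n) \<noteq> 0}. cell Q n) \<le> rate Q"
    (is "emeasure _ (\<Union>n\<in>?J. _) \<le> _")
proof -
  \<comment> \<open>Padding with empty sets turns the union over indices into one over all naturals,
    as countable subadditivity requires.\<close>
  define F where "F n = (if n \<in> ?J then cell Q n else {})" for n
  let ?f = "\<lambda>n. emeasure channel (cell Q n) * ennreal_of_enat (word_length (codeword Q n))"
  have cells: "n \<in> indices Q \<Longrightarrow> cell Q n \<in> sets lebesgue" for n
    using Q by (simp add: is_quantizer_def)
  have le: "emeasure channel (cell Q n) \<le> ?f n" if "n \<in> ?J" for n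
  proof -
    have "1 \<le> word_length (codeword Q n)" using that by (simp add: ileI1 one_eSuc)
    then have "1 \<le> ennreal_of_enat (word_length (codeword Q n))"
      using ennreal_of_enat_le_iff[of 1] by simp
    then show ?thesis using mult_left_mono[of 1 _ "emeasure channel (cell Q n)"] by simp
  qed
  have "emeasure channel (\<Union>n\<in>?J. cell Q n) = emeasure channel (\<Union>n. F n)"
    by (rule arg_cong[where f = "emeasure channel"]) (auto simp: F_def split: if_splits)
  also have "\<dots> \<le> (\<Sum>n. emeasure channel (F n))"
    by (rule emeasure_subadditive_countably) (auto simp: F_def cells)
  also have "\<dots> \<le> rate Q"
  proof (rule suminf_le_const)
    fix N
    have "(\<Sum>n<N. emeasure channel (F n)) = (\<Sum>n\<in>{..<N} \<inter> ?J. emeasure channel (cell Q n))"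
      by (rule sum.mono_neutral_cong_right) (auto simp: F_def)
    also have "\<dots> \<le> (\<Sum>n\<in>{..<N} \<inter> ?J. ?f n)"
      by (intro sum_mono le) auto
    \<comment> \<open>In \<open>ennreal\<close> the infinite sum is the supremum of its finite
      partial sums, one of which is at hand.\<close>
    also have "\<dots> \<le> rate Q"
      unfolding rate_def by (subst nonneg_infsum_complete) (auto intro!: SUP_upper)
    finally show "(\<Sum>n<N. emeasure channel (F n)) \<le> rate Q" .
  qed auto
  finally show ?thesis .
qed

lemma quantize_eq:
  assumes "is_quantizer Q" "n \<in> indices Q" "h \<in> cell Q n"
  shows "quantize Q h = beam Q n"
proof -
  have "(THE n. n \<in> indices Q \<and> h \<in> cell Q n) = n"
    using assms unfolding is_quantizer_def disjoint_family_on_def by (intro the_equality) blast+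
  then show ?thesis by (simp add: quantize_def)
qed

lemma sets_lebesgue_outage:
  assumes Q: "is_quantizer Q"
  shows "{h. (cmod (hermitian_inner (quantize Q h) h))\<^sup>2 < a} \<in> sets lebesgue"
proof -
  have "{h. (cmod (hermitian_inner (quantize Q h) h))\<^sup>2 < a} =
      (\<Union>n\<in>indices Q. cell Q n \<inter> {h. (cmod (hermitian_inner (beam Q n) h))\<^sup>2 < a})"
    using Q quantize_eq[OF Q] by (fastforce simp: is_quantizer_def)
  also have "\<dots> \<in> sets lebesgue"
    using Q by (auto simp: is_quantizer_def intro!: sets.countable_UN' sets.Int sets_lebesgue_beam_outage)
  finally show ?thesis .
qed

text \<open>By Cauchy-Schwarz a unit beam never yields more gain than the full norm.\<close>

lemma full_outage_subset:
  fixes Q :: "'t::finite quantizer"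
  assumes Q: "is_quantizer Q"
  shows "{h. (norm h)\<^sup>2 < a} \<subseteq> {h. (cmod (hermitian_inner (quantize Q h) h))\<^sup>2 < a}"
proof clarify
  fix h :: "complex^'t" assume h: "(norm h)\<^sup>2 < a"
  obtain n where n: "n \<in> indices Q" "h \<in> cell Q n"
    using Q unfolding is_quantizer_def by blast
  have "norm (quantize Q h) = 1"
    using Q n by (simp add: quantize_eq is_quantizer_def beamforming_vectors_def)
  then have "cmod (hermitian_inner (quantize Q h) h) \<le> norm h"
    using cmod_hermitian_inner_le[of "quantize Q h" h] by simp
  then have "(cmod (hermitian_inner (quantize Q h) h))\<^sup>2 \<le> (norm h)\<^sup>2"
    by (intro power_mono) auto
  then show "(cmod (hermitian_inner (quantize Q h) h))\<^sup>2 < a" using h by linarith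
qed

lemma word_length_eq_0_iff: "word_length b = 0 \<longleftrightarrow> b = Finite_Word []"
  by (cases b) (auto simp: zero_enat_def)

text \<open>Distinct codewords leave at most one cell with the empty word; its beam is the witness
  \<open>x\<close>. A channel state in outage for \<open>x\<close> but not for full CSIT is either
  in outage for \<open>Q\<close> as well, which is a null event here, or in a cell with a nonempty
  word, which the rate pays for.\<close>

lemma no_outage_gap_imp_rate_ge:
  fixes Q :: "'t::finite quantizer"
  assumes Q: "is_quantizer Q"
    and le: "outage \<rho> P Q \<le> outage_full TYPE('t) \<rho> P"
  obtains x :: "complex^'t" where "norm x = 1"
    "emeasure channel ({h. (cmod (hermitian_inner x h))\<^sup>2 < outage_threshold \<rho> P} -
      {h. (norm h)\<^sup>2 < outage_threshold \<rho> P}) \<le> rate Q"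
proof -
  let ?a = "outage_threshold \<rho> P"
  let ?J = "{n\<in>indices Q. word_length (codeword Q n) \<noteq> 0}"
  let ?A = "{h. (cmod (hermitian_inner (quantize Q h) h))\<^sup>2 < ?a}"
  let ?B = "{h :: complex^'t. (norm h)\<^sup>2 < ?a}"
  define W where "W = (\<Union>n\<in>?J. cell Q n)"
  have W: "W \<in> sets lebesgue"
    using Q unfolding W_def by (intro sets.countable_UN') (auto simp: is_quantizer_def)
  have AB: "?A - ?B \<in> sets lebesgue"
    by (intro sets.Diff sets_lebesgue_outage Q sets_lebesgue_full_outage)
  have "emeasure channel ?A \<le> emeasure channel ?B"
    using le emeasure_channel_finite[where 't = 't]
    by (simp add: outage_def outage_full_def emeasure_eq_ennreal_measure)
  \<comment> \<open>\<open>?B\<close> lies inside \<open>?A\<close>, so the reverse inequality of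
    finite measures leaves a null difference.\<close>
  then have "emeasure channel (?A - ?B) = 0"
    using emeasure_channel_finite[where 't = 't] full_outage_subset[OF Q]
    by (subst emeasure_Diff)
      (auto simp: sets_lebesgue_outage[OF Q] sets_lebesgue_full_outage diff_eq_0_iff_ennreal less_top)
  moreover have "emeasure channel W \<le> rate Q"
    unfolding W_def by (rule emeasure_nonempty_codeword_le_rate[OF Q])
  moreover have "emeasure channel ((?A - ?B) \<union> W) \<le> emeasure channel (?A - ?B) + emeasure channel W"
    using AB W by (intro emeasure_subadditive) auto
  ultimately have bound: "emeasure channel ((?A - ?B) \<union> W) \<le> rate Q" by simp
  \<comment> \<open>If no cell has the empty word, \<open>W\<close> is the whole space and any index
    serves; one exists because the cells cover a nonempty space.\<close>
  obtain n where n: "n \<in> indices Q" "\<And>h. h \<in> cell Q n \<or> h \<in> W"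
  proof (cases "\<exists>n\<in>indices Q. word_length (codeword Q n) = 0")
    case True
    then obtain n where n: "n \<in> indices Q" "word_length (codeword Q n) = 0" by blast
    have "k \<in> ?J" if "k \<in> indices Q" "k \<noteq> n" for k
      using Q n that by (auto simp: is_quantizer_def word_length_eq_0_iff inj_on_def)
    then have "h \<in> cell Q n \<or> h \<in> W" for h
      using Q unfolding W_def is_quantizer_def by blast
    with n(1) that show ?thesis by blast
  next
    case False
    then have "h \<in> W" for h
      using Q unfolding W_def is_quantizer_def by blast
    moreover obtain n where "n \<in> indices Q" using Q unfolding is_quantizer_def by blast
    ultimately show ?thesis using that by blast
  qed
  have "{h. (cmod (hermitian_inner (beam Q n) h))\<^sup>2 < ?a} - ?B \<subseteq> (?A - ?B) \<union> W"
    using n quantize_eq[OF Q n(1)] by fastforce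
  then have "emeasure channel ({h. (cmod (hermitian_inner (beam Q n) h))\<^sup>2 < ?a} - ?B)
      \<le> emeasure channel ((?A - ?B) \<union> W)"
    using AB W by (intro emeasure_mono) auto
  with bound show ?thesis
    using Q n(1) by (intro that[of "beam Q n"]) (auto simp: is_quantizer_def beamforming_vectors_def)
qed

theorem theorem2:
  fixes Q :: "real \<Rightarrow> 't::finite quantizer" and \<rho> :: real
  assumes "CARD('t) \<ge> 2"
    and "\<rho> > 0"
    and "\<And>P. P > 0 \<Longrightarrow> is_quantizer (Q P)"
    and "\<And>\<epsilon>::real. \<epsilon> > 0 \<Longrightarrow> eventually (\<lambda>P. rate (Q P) \<le> ennreal (\<epsilon> / P)) at_top"
  shows "eventually (\<lambda>P. outage \<rho> P (Q P) > outage_full TYPE('t) \<rho> P) at_top"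
proof -
  obtain c a\<^sub>0 where c: "0 < c" "0 < a\<^sub>0"
    "\<And>a (x :: complex^'t). 0 < a \<Longrightarrow> a \<le> a\<^sub>0 \<Longrightarrow> norm x = 1 \<Longrightarrow>
      ennreal (c * a) \<le> emeasure channel
        ({h :: complex^'t. (cmod (hermitian_inner x h))\<^sup>2 < a} - {h. (norm h)\<^sup>2 < a})"
    using fixed_beam_outage_gap[OF assms(1)] by blast
  define b where "b = 2 powr \<rho> - 1"
  have b: "0 < b" using assms(2) by (simp add: b_def)
  \<comment> \<open>This is half of the gap \<open>c * (b / P)\<close> guaranteed for a fixed beam,
    so the two bounds contradict each other.\<close>
  have "eventually (\<lambda>P. rate (Q P) \<le> ennreal (c * b / 2 / P)) at_top"
    using b c by (intro assms(4)) simp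
  \<comment> \<open>Makes \<open>P\<close> positive and brings the threshold \<open>b / P\<close>
    down to \<open>a\<^sub>0\<close>.\<close>
  moreover have "eventually (\<lambda>P. P \<ge> max 1 (b / a\<^sub>0)) at_top"
    by (rule eventually_ge_at_top)
  ultimately show ?thesis
  proof eventually_elim
    case (elim P)
    then have P: "0 < P" "b / a\<^sub>0 \<le> P" by auto
    have a: "outage_threshold \<rho> P = b / P" "0 < b / P" "b / P \<le> a\<^sub>0"
      using P b c by (auto simp: outage_threshold_def b_def field_simps)
    show ?case
    proof (rule ccontr)
      assume "\<not> outage \<rho> P (Q P) > outage_full TYPE('t) \<rho> P"
      then obtain x :: "complex^'t" where x: "norm x = 1"
        "emeasure channel ({h. (cmod (hermitian_inner x h))\<^sup>2 < outage_threshold \<rho> P} -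
          {h. (norm h)\<^sup>2 < outage_threshold \<rho> P}) \<le> rate (Q P)"
        using no_outage_gap_imp_rate_ge[OF assms(3)[OF P(1)]] by (metis not_less)
      have "ennreal (c * (b / P)) \<le> ennreal (c * b / 2 / P)"
        using c(3)[OF a(2,3) x(1)] x(2) elim(1) unfolding a(1) by (meson order_trans)
      then have "c * (b / P) \<le> c * b / 2 / P"
        using b c P by (subst (asm) ennreal_le_iff) auto
      then show False using b c P by (simp add: field_simps)
    qed
  qed
qed

end
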